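(* Let $n\ge 2$ and $k\ge 1$, let $A^p=\{a^p_1,\dots,a^p_k\}$, $1\le p\le n$, be pairwise disjoint sets of $k$ elements each, and let a symmetric binary relation ("friendship") be given between elements of different sets $A^i$, $A^j$ ($i\ne j$). Let $Z=(a_{i_1 i_2\cdots i_n})_{1\le i_1,\dots,i_n\le k}$ be the multimatrix associated with $A^1,\dots,A^n$. Then there exist $k$ pairwise disjoint sets $B^1,\dots,B^k$, each consisting of exactly one element from each $A^p$ ($1\le p\le n$) and such that any two distinct elements of the same $B^q$ are friends, if and only if at least one multideterminantal monomial of $Z$ is nonzero.
   Context: The multimatrix associated with $A^1,\dots,A^n$ is the array with $k^n$ entries $a_{i_1 i_2\cdots i_n}$, $1\le i_j\le k$, where $a_{i_1 i_2\cdots i_n}=1$ if all the elements of $\{a^1_{i_1},a^2_{i_2},\dots,a^n_{i_n}\}$ are pairwise friends, and $a_{i_1 i_2\cdots i_n}=0$ otherwise. The multideterminant of a multimatrix $Z$ is $$\mathrm{Det}(Z)=\sum_{\lambda_1,\dots,\lambda_{n-1}\in S_k}\ \prod_{i=1}^{n-1}\mathrm{sgn}(\lambda_i)\ \prod_{j=1}^{k} a_{j\,\lambda_1(j)\cdots\lambda_{n-1}(j)},$$ where $S_k$ is the group of permutations of $\{1,\dots,k\}$ and $\mathrm{sgn}$ is the sign of a permutation. A multideterminantal monomial of $Z$ is an individual term of this sum, i.e. the term $\prod_{i=1}^{n-1}\mathrm{sgn}(\lambda_i)\prod_{j=1}^{k} a_{j\,\lambda_1(j)\cdots\lambda_{n-1}(j)}$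 for one choice of $(\lambda_1,\dots,\lambda_{n-1})\in S_k^{\,n-1}$; there are $(k!)^{n-1}$ of them. *)

theory Defs
  imports "HOL-Library.FuncSet" "HOL-Library.Disjoint_Sets" "HOL-Combinatorics.Permutations"
begin

text \<open>
  An \<open>n\<close>-dimensional multimatrix of side \<open>k\<close> is a function on index tuples
  \<open>i \<in> {1..n} \<rightarrow>\<^sub>E {1..k}\<close>, where \<open>i p\<close> is the \<open>p\<close>-th index; its values at
  other arguments are never used. The element \<open>a\<^sup>p\<^sub>i\<close> is written \<open>a p i\<close>. The library's
  \<^const>\<open>pairwise\<close> quantifies over distinct elements only.
\<close>

definition assoc_multimatrix ::
    "nat \<Rightarrow> (nat \<Rightarrow> nat \<Rightarrow> 'a) \<Rightarrow> ('a \<Rightarrow> 'a \<Rightarrow> bool) \<Rightarrow> (nat \<Rightarrow> nat) \<Rightarrow> 'r::comm_ring_1"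
  where "assoc_multimatrix n a friend i =
    (if pairwise friend {a p (i p) | p. p \<in> {1..n}} then 1 else 0)"

definition perm_tuples :: "nat \<Rightarrow> nat \<Rightarrow> (nat \<Rightarrow> nat \<Rightarrow> nat) set"
  where "perm_tuples n k = {1..n-1} \<rightarrow>\<^sub>E {\<pi>. \<pi> permutes {1..k}}"

text \<open>The index tuple \<open>(j, \<lambda>\<^sub>1(j), \<dots>, \<lambda>\<^sub>n\<^sub>-\<^sub>1(j))\<close>, with \<open>l\<close> for \<open>\<lambda>\<close>.\<close>

definition perm_index :: "nat \<Rightarrow> (nat \<Rightarrow> nat \<Rightarrow> nat) \<Rightarrow> nat \<Rightarrow> nat \<Rightarrow> nat"
  where "perm_index n l j = (\<lambda>p\<in>{1..n}. if p = 1 then j else l (p - 1) j)"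

definition multidet_monomial ::
    "nat \<Rightarrow> nat \<Rightarrow> ((nat \<Rightarrow> nat) \<Rightarrow> 'r::comm_ring_1) \<Rightarrow> (nat \<Rightarrow> nat \<Rightarrow> nat) \<Rightarrow> 'r"
  where "multidet_monomial n k Z l =
    (\<Prod>i=1..n-1. of_int (sign (l i))) * (\<Prod>j=1..k. Z (perm_index n l j))"

definition multidet :: "nat \<Rightarrow> nat \<Rightarrow> ((nat \<Rightarrow> nat) \<Rightarrow> 'r::comm_ring_1) \<Rightarrow> 'r"
  where "multidet n k Z = (\<Sum>l\<in>perm_tuples n k. multidet_monomial n k Z l)"

end

theory Submission
  imports Defs
begin

text \<open>Signs are 1 or -1 and the integers form a domain, so the monomial of \<open>l\<close> is
  nonzero exactly when all \<open>k\<close> of its entries are, that is, when each index tuple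
  \<open>perm_index n l j\<close> selects pairwise friends. It remains to match tuples of
  permutations with systems of sets. A disjoint system \<open>B\<close> picks in each
  \<open>A p\<close> one element per set; the indices picked form a self-map \<open>s p\<close> of
  \<open>{1..k}\<close>, injective by disjointness and hence bijective. Relabelling each set by the
  index of its element in \<open>A 1\<close> turns \<open>s 1\<close> into the identity and leaves
  \<open>n - 1\<close> permutations (\<open>perm_tuple_of_bijections\<close>). Conversely, the
  \<open>k\<close> tuples of a given \<open>l\<close> differ pairwise in every coordinate
  (\<open>perm_index_permutes\<close>), so the sets they select are disjoint.\<close>

lemma multidet_monomial_nonzero_iff:
  fixes Z :: "(nat \<Rightarrow> nat) \<Rightarrow> 'r::idom"
  shows "multidet_monomial n k Z l \<noteq> 0 \<longleftrightarrow> (\<forall>j\<in>{1..k}. Z (perm_index n l j) \<noteq> 0)"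
proof -
  have "of_int (sign \<pi>) \<noteq> (0::'r)" for \<pi> :: "nat \<Rightarrow> nat"
    by (simp add: sign_def)
  then show ?thesis
    by (simp add: multidet_monomial_def)
qed

lemma assoc_multimatrix_nonzero_iff:
  "(assoc_multimatrix n a friend i :: 'r::comm_ring_1) \<noteq> 0 \<longleftrightarrow>
    pairwise friend ((\<lambda>p. a p (i p)) ` {1..n})"
  unfolding assoc_multimatrix_def setcompr_eq_image Collect_mem_eq by simp

text \<open>Coordinate 1 gives the identity and coordinate \<open>p > 1\<close> gives
  \<open>l (p - 1)\<close>. Injectivity in \<open>j\<close> later yields disjointness of the
  selected sets.\<close>

lemma perm_index_permutes:
  assumes "l \<in> perm_tuples n k" and "p \<in> {1..n}"
  shows "(\<lambda>j. perm_index n l j p) permutes {1..k}"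
proof (cases "p = 1")
  case True
  with assms(2) show ?thesis
    using permutes_id[of "{1..k}"] by (simp add: perm_index_def id_def)
next
  case False
  with assms(2) have "p - 1 \<in> {1..n-1}"
    by auto
  with assms(1) have "l (p - 1) permutes {1..k}"
    unfolding perm_tuples_def by blast
  with False assms(2) show ?thesis
    by (simp add: perm_index_def)
qed

text \<open>The labels \<open>q\<close> are arbitrary, so they may be replaced by
  \<open>s 1 q\<close>; coordinate \<open>p\<close> is then given by \<open>s p\<close> composed
  with the inverse of \<open>s 1\<close>.\<close>

lemma perm_tuple_of_bijections:
  assumes "n \<ge> 1" and s: "\<And>p. p \<in> {1..n} \<Longrightarrow> bij_betw (s p) {1..k} {1..k}"
  shows "\<exists>l\<in>perm_tuples n k. \<forall>p\<in>{1..n}. \<forall>q\<in>{1..k}. perm_index n l (s 1 q) p = s p q"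
proof -
  define r where "r = inv_into {1..k} (s 1)"
  \<comment> \<open>The shift \<open>i + 1\<close> reflects that permutation \<open>i\<close>
    governs coordinate \<open>i + 1\<close>. Outside \<open>{1..k}\<close> it must be the identity,
    as \<open>permutes\<close> demands.\<close>
  define l where "l = (\<lambda>i\<in>{1..n-1}. \<lambda>j. if j \<in> {1..k} then s (i + 1) (r j) else j)"
  have s1: "bij_betw (s 1) {1..k} {1..k}"
    using assms by simp
  have r: "bij_betw r {1..k} {1..k}"
    unfolding r_def using s1 by (rule bij_betw_inv_into)
  have "l i permutes {1..k}" if i: "i \<in> {1..n-1}" for i
  proof (rule bij_imp_permutes)
    have "i + 1 \<in> {1..n}"
      using i by auto
    then have "bij_betw (s (i + 1) \<circ> r) {1..k} {1..k}"
      using bij_betw_trans[OF r s] by blast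
    then show "bij_betw (l i) {1..k} {1..k}"
      by (rule bij_betw_cong[THEN iffD1, rotated]) (use i in \<open>simp add: l_def\<close>)
    show "l i j = j" if "j \<notin> {1..k}" for j
      using i that by (auto simp: l_def)
  qed
  then have "l \<in> perm_tuples n k"
    unfolding perm_tuples_def by (auto simp: l_def)
  moreover have "perm_index n l (s 1 q) p = s p q" if p: "p \<in> {1..n}" and q: "q \<in> {1..k}" for p q
  proof (cases "p = 1")
    case True
    with p show ?thesis
      by (simp add: perm_index_def)
  next
    case False
    with p have i: "p - 1 \<in> {1..n-1}" and p': "p - 1 + 1 = p"
      by auto
    have "r (s 1 q) = q" and "s 1 q \<in> {1..k}"
      using s1 q by (auto simp: r_def bij_betw_inv_into_left dest: bij_betwE)
    then have "l (p - 1) (s 1 q) = s p q"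
      unfolding l_def restrict_apply'[OF i] p' by presburger
    with False p show ?thesis
      by (simp add: perm_index_def)
  qed
  ultimately show ?thesis
    by blast
qed

theorem lemma2p1:
  fixes n k :: nat
    and A :: "nat \<Rightarrow> 'a set"
    and a :: "nat \<Rightarrow> nat \<Rightarrow> 'a"
    and friend :: "'a \<Rightarrow> 'a \<Rightarrow> bool"
    and Z :: "(nat \<Rightarrow> nat) \<Rightarrow> int"
  assumes "n \<ge> 2" and "k \<ge> 1"
    and "\<And>p. p \<in> {1..n} \<Longrightarrow> bij_betw (a p) {1..k} (A p)"
    and "disjoint_family_on A {1..n}"
    and "\<And>p q x y. p \<in> {1..n} \<Longrightarrow> q \<in> {1..n} \<Longrightarrow> p \<noteq> q \<Longrightarrow> x \<in> A p \<Longrightarrow> y \<in> A q \<Longrightarrow>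
           friend x y \<longleftrightarrow> friend y x"
    and "Z = assoc_multimatrix n a friend"
  shows "(\<exists>B :: nat \<Rightarrow> 'a set. disjoint_family_on B {1..k} \<and>
            (\<forall>q\<in>{1..k}. B q \<subseteq> (\<Union>p\<in>{1..n}. A p) \<and>
               (\<forall>p\<in>{1..n}. \<exists>!x. x \<in> B q \<inter> A p) \<and>
               pairwise friend (B q)))
         \<longleftrightarrow> (\<exists>l\<in>perm_tuples n k. multidet_monomial n k Z l \<noteq> 0)"
proof -
  note bij = assms(3) and disj = assms(4)
  have Z_nonzero: "multidet_monomial n k Z l \<noteq> 0 \<longleftrightarrow>
      (\<forall>j\<in>{1..k}. pairwise friend ((\<lambda>p. a p (perm_index n l j p)) ` {1..n}))" for l
    by (simp only: multidet_monomial_nonzero_iff \<open>Z = _\<close> assoc_multimatrix_nonzero_iff)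
  show ?thesis
  proof (intro iffI; elim exE bexE conjE)
    fix B :: "nat \<Rightarrow> 'a set"
    assume B_disj: "disjoint_family_on B {1..k}"
      and B: "\<forall>q\<in>{1..k}. B q \<subseteq> (\<Union>p\<in>{1..n}. A p) \<and>
               (\<forall>p\<in>{1..n}. \<exists>!x. x \<in> B q \<inter> A p) \<and> pairwise friend (B q)"
    have "\<exists>i\<in>{1..k}. a p i \<in> B q" if p: "p \<in> {1..n}" and q: "q \<in> {1..k}" for p q
    proof -
      obtain x where "x \<in> B q" "x \<in> A p"
        using B p q by blast
      moreover from \<open>x \<in> A p\<close> obtain i where "i \<in> {1..k}" "x = a p i"
        unfolding bij_betw_imp_surj_on[OF bij[OF p], symmetric] by (rule imageE)
      ultimately show ?thesis
        by blast
    qed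
    \<comment> \<open>\<open>s p q\<close> is the index in \<open>A p\<close> of the element that
      \<open>B q\<close> takes from it.\<close>
    then obtain s where s: "\<And>p q. p \<in> {1..n} \<Longrightarrow> q \<in> {1..k} \<Longrightarrow> s p q \<in> {1..k} \<and> a p (s p q) \<in> B q"
      by metis
    have s_bij: "bij_betw (s p) {1..k} {1..k}" if p: "p \<in> {1..n}" for p
    proof -
      \<comment> \<open>Equal indices would give \<open>B q\<close> and \<open>B q'\<close> a common
        element. Surjectivity then follows from finiteness.\<close>
      have "inj_on (s p) {1..k}"
      proof (rule inj_onI)
        fix q q' assume q: "q \<in> {1..k}" "q' \<in> {1..k}" and "s p q = s p q'"
        then have "a p (s p q) \<in> B q \<inter> B q'"
          using s[OF p q(1)] s[OF p q(2)] by simp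
        with B_disj q show "q = q'"
          unfolding disjoint_family_on_def by blast
      qed
      moreover have "s p ` {1..k} \<subseteq> {1..k}"
        using s p by blast
      ultimately show ?thesis
        by (simp add: bij_betw_def endo_inj_surj)
    qed
    have "n \<ge> 1" and s1: "bij_betw (s 1) {1..k} {1..k}"
      using \<open>n \<ge> 2\<close> s_bij by auto
    have "\<exists>l\<in>perm_tuples n k. \<forall>p\<in>{1..n}. \<forall>q\<in>{1..k}. perm_index n l (s 1 q) p = s p q"
      using \<open>n \<ge> 1\<close> by (rule perm_tuple_of_bijections) (rule s_bij)
    then obtain l where l: "l \<in> perm_tuples n k"
      and l_s: "\<forall>p\<in>{1..n}. \<forall>q\<in>{1..k}. perm_index n l (s 1 q) p = s p q"
      by (rule bexE)
    have "pairwise friend ((\<lambda>p. a p (perm_index n l j p)) ` {1..n})" if "j \<in> {1..k}" for j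
    proof -
      \<comment> \<open>The tuple with first index \<open>j\<close> is traced back to the set
        \<open>B q\<close> that contains \<open>a 1 j\<close>; friendship is inherited from that
        set.\<close>
      have "j \<in> s 1 ` {1..k}"
        using that by (simp only: bij_betw_imp_surj_on[OF s1])
      then obtain q where q: "q \<in> {1..k}" and j: "j = s 1 q"
        by blast
      have "(\<lambda>p. a p (perm_index n l j p)) ` {1..n} \<subseteq> B q"
      proof (rule image_subsetI)
        fix p assume p: "p \<in> {1..n}"
        show "a p (perm_index n l j p) \<in> B q"
          using s[OF p q] unfolding j bspec[OF bspec[OF l_s p] q] by (rule conjunct2)
      qed
      moreover have "pairwise friend (B q)"
        using B q by blast
      ultimately show ?thesis
        by (rule pairwise_subset[rotated])
    qed
    with l show "\<exists>l\<in>perm_tuples n k. multidet_monomial n k Z l \<noteq> 0"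
      unfolding Z_nonzero by blast
  next
    fix l assume l: "l \<in> perm_tuples n k" and nonzero: "multidet_monomial n k Z l \<noteq> 0"
    \<comment> \<open>The witness: \<open>B j\<close> consists of the elements selected by the
      \<open>j\<close>-th factor of the monomial.\<close>
    define b where "b j p = a p (perm_index n l j p)" for j p
    define B where "B j = b j ` {1..n}" for j
    have index: "perm_index n l j p \<in> {1..k}" if "p \<in> {1..n}" "j \<in> {1..k}" for p j
      using permutes_in_image[OF perm_index_permutes[OF l that(1)]] that(2) by blast
    have b_in: "b j p \<in> A p" if "p \<in> {1..n}" "j \<in> {1..k}" for p j
      unfolding b_def using bij_betwE[OF bij[OF that(1)]] index[OF that] by blast
    \<comment> \<open>Since the \<open>A p\<close> are disjoint, a selected element determines its
      coordinate. Both the disjointness of the \<open>B j\<close> and the uniqueness in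
      \<open>B j \<inter> A p\<close> rest on this.\<close>
    have b_A: "p = p'" if "p \<in> {1..n}" "p' \<in> {1..n}" "j \<in> {1..k}" "b j p \<in> A p'" for p p' j
      using disj b_in[OF that(1,3)] that unfolding disjoint_family_on_def by blast
    have "disjoint_family_on B {1..k}"
      unfolding disjoint_family_on_def
    proof (intro ballI impI, rule ccontr)
      fix j j' assume j: "j \<in> {1..k}" "j' \<in> {1..k}" "j \<noteq> j'" and "B j \<inter> B j' \<noteq> {}"
      then obtain p p' where p: "p \<in> {1..n}" "p' \<in> {1..n}" and eq: "b j p = b j' p'"
        unfolding B_def by blast
      have "p = p'"
        using b_A[OF p j(1)] b_in[OF p(2) j(2)] eq by simp
      \<comment> \<open>A common element lies in a single \<open>A p\<close>; cancelling the
        injective \<open>a p\<close> and then the permutation in coordinate \<open>p\<close> forces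
        \<open>j = j'\<close>.\<close>
      then have "perm_index n l j p = perm_index n l j' p"
        using eq inj_onD[OF bij_betw_imp_inj_on[OF bij[OF p(1)]]] index[OF p(1)] j
        by (simp add: b_def)
      with permutes_inj[OF perm_index_permutes[OF l p(1)]] have "j = j'"
        by (rule injD)
      with j show False
        by simp
    qed
    moreover have "B j \<subseteq> (\<Union>p\<in>{1..n}. A p)" if "j \<in> {1..k}" for j
      unfolding B_def using b_in that by blast
    moreover have "\<exists>!x. x \<in> B j \<inter> A p" if "j \<in> {1..k}" "p \<in> {1..n}" for j p
    proof (rule ex1I)
      show "b j p \<in> B j \<inter> A p"
        unfolding B_def using b_in that by blast
      show "x = b j p" if "x \<in> B j \<inter> A p" for x
        using that b_A[OF _ \<open>p \<in> _\<close> \<open>j \<in> _\<close>] unfolding B_def by blast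
    qed
    moreover have "pairwise friend (B j)" if "j \<in> {1..k}" for j
      using nonzero that unfolding Z_nonzero B_def b_def by blast
    ultimately show "\<exists>B :: nat \<Rightarrow> 'a set. disjoint_family_on B {1..k} \<and>
        (\<forall>q\<in>{1..k}. B q \<subseteq> (\<Union>p\<in>{1..n}. A p) \<and>
          (\<forall>p\<in>{1..n}. \<exists>!x. x \<in> B q \<inter> A p) \<and> pairwise friend (B q))"
      by blast
  qed
qed

end
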